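(* Let $f\in\mathcal F_{num}$, and for $x,y>0$ let $m_f(x,y)=y\,f(y^{-1}x)$. The inequality $$\mathrm{E}\bigl(m_f(X,Y)\bigr)\le m_f\bigl(\mathrm{E}(X),\mathrm{E}(Y)\bigr)$$ holds for arbitrary positive random variables $X$ and $Y$ if and only if $f$ is concave.
   Context: Write $\mathbb R_+=(0,+\infty)$. $\mathcal F_{num}$ denotes the class of functions $f\colon\mathbb R_+\to\mathbb R_+$ such that: (1) $f$ is continuous; (2) $f$ is monotone increasing; (3) $f(1)=1$; (4) $t f(t^{-1})=f(t)$ for all $t>0$. Positive random variables are random variables $X,Y\colon\Omega\to(0,+\infty)$ defined on a common probability space $\Omega$, which is not fixed in advance: the inequality is required for all such pairs on all probability spaces. $\mathrm{E}$ denotes expectation with respect to the underlying probability measure. *)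

theory Defs
  imports "HOL-Probability.Probability"
begin

text \<open>Functions on the positive half-line are total functions on the reals of which only the
  values on \<open>{0<..}\<close> matter. ``Increasing'' is meant in the weak sense, so that for instance
  \<open>min 1\<close> (giving the mean \<open>min x y\<close>) belongs to the class.\<close>

definition F_num :: "(real \<Rightarrow> real) set" where
  "F_num = {f. (\<forall>t>0. f t > 0) \<and> continuous_on {0<..} f \<and> mono_on {0<..} f \<and> f 1 = 1 \<and>
               (\<forall>t>0. t * f (inverse t) = f t)}"

definition mean_of :: "(real \<Rightarrow> real) \<Rightarrow> real \<Rightarrow> real \<Rightarrow> real" where
  "mean_of f x y = y * f (inverse y * x)"

text \<open>The inequality for all pairs of positive random variables on all probability spaces whose
  outcomes are of type \<open>'a\<close> (the sample space being any set of such outcomes). HOL cannot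
  quantify over \<open>'a\<close> inside a formula, whence the type argument. The type \<open>real \<times> real\<close> carries the
  joint law of every pair \<open>(X, Y)\<close>, so it already accounts for all pairs. Integrability of \<open>X\<close> and \<open>Y\<close> is
  needed for the right-hand side, as \<open>mean_of f\<close> takes finite arguments; it makes \<open>X\<close> and \<open>Y\<close>
  measurable, and the left-hand side a genuine expectation by \<open>integrable_mean_of\<close> below.\<close>

definition expectation_inequality :: "'a itself \<Rightarrow> (real \<Rightarrow> real) \<Rightarrow> bool" where
  "expectation_inequality _ f \<longleftrightarrow>
     (\<forall>(M :: 'a measure) X Y. prob_space M \<longrightarrow>
        integrable M X \<longrightarrow> integrable M Y \<longrightarrow>
        (\<forall>\<omega>\<in>space M. X \<omega> > 0) \<longrightarrow> (\<forall>\<omega>\<in>space M. Y \<omega> > 0) \<longrightarrow>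
        prob_space.expectation M (\<lambda>\<omega>. mean_of f (X \<omega>) (Y \<omega>))
          \<le> mean_of f (prob_space.expectation M X) (prob_space.expectation M Y))"

lemma F_num_le_max:
  assumes "f \<in> F_num" "t > 0"
  shows "f t \<le> max 1 t"
proof -
  have mono: "f s \<le> 1" if "0 < s" "s \<le> 1" for s
    using mono_onD[of "{0<..}" f s 1] assms(1) that by (simp add: F_num_def)
  show ?thesis
  proof (cases "t \<le> 1")
    case True
    then show ?thesis using mono[of t] assms(2) by simp
  next
    case False
    then have "f (inverse t) \<le> 1"
      using mono[of "inverse t"] by (simp add: inverse_le_1_iff)
    then have "t * f (inverse t) \<le> t * 1"
      using assms(2) by (intro mult_left_mono) auto
    moreover have "t * f (inverse t) = f t"
      using assms by (simp add: F_num_def)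
    ultimately show ?thesis by simp
  qed
qed

lemma integrable_mean_of:
  fixes M :: "'a measure"
  assumes f: "f \<in> F_num"
    and X: "integrable M X" "\<forall>\<omega>\<in>space M. X \<omega> > 0"
    and Y: "integrable M Y" "\<forall>\<omega>\<in>space M. Y \<omega> > 0"
  shows "integrable M (\<lambda>\<omega>. mean_of f (X \<omega>) (Y \<omega>))"
proof (rule Bochner_Integration.integrable_bound)
  show "integrable M (\<lambda>\<omega>. X \<omega> + Y \<omega>)" using X Y by simp
  have [measurable]: "X \<in> borel_measurable M" "Y \<in> borel_measurable M" using X Y by auto
  have g: "(\<lambda>t. indicator {0<..} t *\<^sub>R f t) \<in> borel_measurable borel"
    using f by (intro borel_measurable_continuous_on_indicator) (auto simp: F_num_def)
  have "(\<lambda>\<omega>. Y \<omega> * (indicator {0<..} (inverse (Y \<omega>) * X \<omega>) *\<^sub>R f (inverse (Y \<omega>) * X \<omega>)))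
          \<in> borel_measurable M"
    by (intro borel_measurable_times measurable_compose[OF _ g]) measurable
  then show "(\<lambda>\<omega>. mean_of f (X \<omega>) (Y \<omega>)) \<in> borel_measurable M"
    by (rule measurable_cong[THEN iffD1, rotated]) (use X Y in \<open>auto simp: mean_of_def\<close>)
  show "AE \<omega> in M. norm (mean_of f (X \<omega>) (Y \<omega>)) \<le> norm (X \<omega> + Y \<omega>)"
  proof (rule AE_I2)
    fix \<omega> assume "\<omega> \<in> space M"
    then have pos: "X \<omega> > 0" "Y \<omega> > 0" using X Y by auto
    then have t: "inverse (Y \<omega>) * X \<omega> > 0" by simp
    have "Y \<omega> * f (inverse (Y \<omega>) * X \<omega>) \<le> Y \<omega> * max 1 (inverse (Y \<omega>) * X \<omega>)"
      using F_num_le_max[OF f t] pos by (intro mult_left_mono) auto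
    also have "\<dots> \<le> Y \<omega> * (1 + inverse (Y \<omega>) * X \<omega>)"
      using t pos by (intro mult_left_mono) auto
    also have "\<dots> = X \<omega> + Y \<omega>" using pos by (simp add: field_simps)
    finally have "mean_of f (X \<omega>) (Y \<omega>) \<le> X \<omega> + Y \<omega>" by (simp add: mean_of_def)
    moreover have "mean_of f (X \<omega>) (Y \<omega>) > 0"
      using f t pos by (simp add: mean_of_def F_num_def)
    ultimately show "norm (mean_of f (X \<omega>) (Y \<omega>)) \<le> norm (X \<omega> + Y \<omega>)" by simp
  qed
qed

end

theory Submission
  imports Defs
begin

text \<open>If \<open>f\<close> is concave and \<open>t\<^sub>0 = E X / E Y\<close>, a supporting line \<open>f t \<le> f t\<^sub>0 + c (t - t\<^sub>0)\<close>
  multiplied by \<open>Y\<close> at \<open>t = X / Y\<close> reads \<open>Y f (X / Y) \<le> Y f t\<^sub>0 + c (X - t\<^sub>0 Y)\<close>, and the last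
  term has expectation zero. Conversely, the inequality for \<open>Y = 1\<close> and a two-valued \<open>X\<close> is
  concavity itself.\<close>

lemma concave_on_supporting_line:
  fixes f :: "real \<Rightarrow> real"
  assumes "concave_on S f" "x \<in> interior S"
  obtains c where "\<And>y. y \<in> S \<Longrightarrow> f y \<le> f x + c * (y - x)"
proof
  \<comment> \<open>The infimum of the slopes of the secants of \<open>- f\<close> from
    \<open>x\<close> to points on its right, that is the right derivative of the convex function
    \<open>- f\<close> at \<open>x\<close>. As \<open>x\<close> is interior, there are points of
    \<open>S\<close> on both sides: those on the right make the set nonempty, and a secant from the
    left bounds it below.\<close>
  define d where "d = Inf ((\<lambda>t. (- f x - - f t) / (x - t)) ` ({x<..} \<inter> S))"
  show "f y \<le> f x + (- d) * (y - x)" if "y \<in> S" for y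
    using convex_le_Inf_differential[of S "\<lambda>x. - f x" x y] assms that
    unfolding concave_on_def d_def by simp
qed

lemma expectation_inequality_if_concave_on:
  assumes f: "f \<in> F_num" "concave_on {0<..} f"
  shows "expectation_inequality TYPE('a) f"
  unfolding expectation_inequality_def
proof (intro allI impI)
  fix M :: "'a measure" and X Y :: "'a \<Rightarrow> real"
  assume "prob_space M" and "integrable M X" "integrable M Y"
    and "\<forall>\<omega>\<in>space M. X \<omega> > 0" "\<forall>\<omega>\<in>space M. Y \<omega> > 0"
  then have X: "integrable M X" "\<forall>\<omega>\<in>space M. X \<omega> > 0"
    and Y: "integrable M Y" "\<forall>\<omega>\<in>space M. Y \<omega> > 0" by auto
  interpret prob_space M by (rule \<open>prob_space M\<close>)
  \<comment> \<open>Strict positivity places \<open>t0\<close> in the open half-line, where every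
    point is interior and so has a supporting line.\<close>
  have EX: "expectation X > 0" using X by (intro expectation_greater AE_I2) auto
  have EY: "expectation Y > 0" using Y by (intro expectation_greater AE_I2) auto
  define t0 where "t0 = inverse (expectation Y) * expectation X"
  have "t0 > 0" using EX EY by (simp add: t0_def)
  then obtain c where c: "\<And>t. t \<in> {0<..} \<Longrightarrow> f t \<le> f t0 + c * (t - t0)"
    using concave_on_supporting_line[OF f(2), of t0] by (auto simp: interior_open)
  have "expectation (\<lambda>\<omega>. mean_of f (X \<omega>) (Y \<omega>))
          \<le> expectation (\<lambda>\<omega>. Y \<omega> * f t0 + c * (X \<omega> - t0 * Y \<omega>))"
  proof (rule integral_mono)
    \<comment> \<open>Membership in \<open>F_num\<close> enters here: it gives
      \<open>0 < mean_of f x y \<le> x + y\<close>. Without integrability the expectation on the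
      left would be the default value 0.\<close>
    show "integrable M (\<lambda>\<omega>. mean_of f (X \<omega>) (Y \<omega>))"
      using f(1) X Y by (rule integrable_mean_of)
    show "integrable M (\<lambda>\<omega>. Y \<omega> * f t0 + c * (X \<omega> - t0 * Y \<omega>))"
      using X Y by simp
    fix \<omega> assume "\<omega> \<in> space M"
    then have pos: "X \<omega> > 0" "Y \<omega> > 0" using X Y by auto
    then have "mean_of f (X \<omega>) (Y \<omega>) \<le> Y \<omega> * (f t0 + c * (inverse (Y \<omega>) * X \<omega> - t0))"
      unfolding mean_of_def by (intro mult_left_mono c) auto
    also have "\<dots> = Y \<omega> * f t0 + c * (X \<omega> - t0 * Y \<omega>)"
      using pos by (simp add: field_simps)
    finally show "mean_of f (X \<omega>) (Y \<omega>) \<le> Y \<omega> * f t0 + c * (X \<omega> - t0 * Y \<omega>)" .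
  qed
  also have "\<dots> = expectation Y * f t0 + c * (expectation X - t0 * expectation Y)"
    using X Y by simp
  also have "\<dots> = mean_of f (expectation X) (expectation Y)"
    using EY by (simp add: mean_of_def t0_def)
  finally show "expectation (\<lambda>\<omega>. mean_of f (X \<omega>) (Y \<omega>))
      \<le> mean_of f (expectation X) (expectation Y)" .
qed

text \<open>Two distinct outcomes are enough to carry a two-valued \<open>X\<close>. On a type with
  one element \<open>X\<close> and \<open>Y\<close> are constant, and the inequality is an equality
  for every \<open>f\<close>.\<close>

lemma concave_on_if_expectation_inequality:
  assumes "expectation_inequality TYPE('a) f" and ab: "(a :: 'a) \<noteq> b"
  shows "concave_on {0<..} f"
  unfolding concave_on_def
proof (rule convex_onI)
  fix p u v :: real
  assume p: "0 < p" "p < 1" and "u \<in> {0<..}" "v \<in> {0<..}"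
  \<comment> \<open>\<open>b\<close> has mass \<open>p\<close> and \<open>a\<close> has mass
    \<open>1 - p\<close>, so that \<open>X\<close> has mean \<open>(1 - p) * u + p * v\<close>, the
    weights of \<open>convex_onI\<close>.\<close>
  define q where "q = map_pmf (\<lambda>c. if c then b else a) (bernoulli_pmf p)"
  define X where "X \<omega> = (if \<omega> = a then u else v)" for \<omega>
  have fin: "finite (set_pmf q)" by (simp add: q_def)
  have E: "measure_pmf.expectation q g = p * g b + (1 - p) * g a" for g :: "'a \<Rightarrow> real"
    using p by (simp add: q_def)
  have "measure_pmf.expectation q (\<lambda>\<omega>. mean_of f (X \<omega>) 1)
          \<le> mean_of f (measure_pmf.expectation q X) (measure_pmf.expectation q (\<lambda>_. 1))"
    using \<open>u \<in> _\<close> \<open>v \<in> _\<close>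
    by (intro assms(1)[unfolded expectation_inequality_def, rule_format])
      (auto simp: X_def prob_space_measure_pmf integrable_measure_pmf_finite[OF fin])
  then show "- f ((1 - p) *\<^sub>R u + p *\<^sub>R v) \<le> (1 - p) * - f u + p * - f v"
    using ab by (simp add: E mean_of_def X_def algebra_simps)
qed (rule convex_real_interval)

theorem theorem4p1:
  fixes f :: "real \<Rightarrow> real"
  assumes "f \<in> F_num"
  shows "(expectation_inequality TYPE(real \<times> real) f \<longleftrightarrow> concave_on {0<..} f) \<and>
         (concave_on {0<..} f \<longrightarrow> expectation_inequality TYPE('a) f)"
  \<comment> \<open>Any two distinct points of the plane would serve.\<close>
  using concave_on_if_expectation_inequality[of f "(0, 0) :: real \<times> real" "(1, 1)"]
    expectation_inequality_if_concave_on[OF assms, where ?'a = "real \<times> real"]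
    expectation_inequality_if_concave_on[OF assms, where ?'a = 'a]
  by auto

end
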